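(* Let $k,D,n$ be any positive integers with $k>1000\ln n$, let $\frac{707\ln n}{k}\leq p\leq 1$ be a real number, and let $G$ be an $n$-vertex $k$-edge-connected graph of diameter $D$. Let $G'$ be a subgraph of $G$ with $V(G')=V(G)$, where every edge $e\in E(G)$ is added to $G'$ with probability $p$ independently from other edges. Then, with probability at least $1-1/\mathrm{poly}(n)$, $G'$ is a connected graph, and its diameter is bounded by $k^{D(D+1)/2}$.
   Context: Graphs are finite, undirected, unweighted, without loops; parallel edges are allowed. A graph is $k$-edge-connected if it remains connected after deletion of any set of at most $k-1$ edges. *)

theory Defs
  imports "HOL-Probability.Probability" "HOL-Library.Extended_Nat"
begin

text \<open>
  Undirected multigraphs without loops: edges are objects of their own, and distinct edges may have
  the same set of endpoints.
\<close>

record ('v, 'e) multigraph =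
  verts :: "'v set"
  edges :: "'e set"
  ends :: "'e \<Rightarrow> 'v set"

locale fin_multigraph =
  fixes G :: "('v, 'e) multigraph" (structure)
  assumes finite_verts: "finite (verts G)"
    and finite_edges: "finite (edges G)"
    and ends_subset: "e \<in> edges G \<Longrightarrow> ends G e \<subseteq> verts G"
    and card_ends: "e \<in> edges G \<Longrightarrow> card (ends G e) = 2"

definition adj :: "('v, 'e) multigraph \<Rightarrow> ('v \<times> 'v) set" where
  "adj G = {(u, v). \<exists>e \<in> edges G. ends G e = {u, v}}"

definition graph_connected :: "('v, 'e) multigraph \<Rightarrow> bool" where
  "graph_connected G \<longleftrightarrow> (\<forall>u \<in> verts G. \<forall>v \<in> verts G. (u, v) \<in> (adj G)\<^sup>*)"

text \<open>
  The pair \<open>(u, v)\<close> lies in the \<open>l\<close>-th power of the adjacency relation iff there is a walk with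
  \<open>l\<close> edges from \<open>u\<close> to \<open>v\<close>. If there is no walk at all, the infimum is over the empty set and
  the distance is \<open>\<infinity>\<close>.
\<close>

definition graph_dist :: "('v, 'e) multigraph \<Rightarrow> 'v \<Rightarrow> 'v \<Rightarrow> enat" where
  "graph_dist G u v = (INF l \<in> {l. (u, v) \<in> adj G ^^ l}. enat l)"

definition graph_diameter :: "('v, 'e) multigraph \<Rightarrow> enat" where
  "graph_diameter G = (SUP u \<in> verts G. SUP v \<in> verts G. graph_dist G u v)"

definition spanning_subgraph :: "('v, 'e) multigraph \<Rightarrow> 'e set \<Rightarrow> ('v, 'e) multigraph" where
  "spanning_subgraph G F = G\<lparr>edges := F\<rparr>"

definition k_edge_connected :: "nat \<Rightarrow> ('v, 'e) multigraph \<Rightarrow> bool" where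
  "k_edge_connected k G \<longleftrightarrow>
     (\<forall>F \<subseteq> edges G. card F \<le> k - 1 \<longrightarrow> graph_connected (spanning_subgraph G (edges G - F)))"

text \<open>
  The random spanning subgraph that keeps each edge independently with probability \<open>p\<close>. The second
  argument of \<open>Pi_pmf\<close> is only the value taken outside \<open>edges G\<close>.
\<close>

definition random_subgraph :: "real \<Rightarrow> ('v, 'e) multigraph \<Rightarrow> ('v, 'e) multigraph pmf" where
  "random_subgraph p G =
     map_pmf (\<lambda>kept. spanning_subgraph G {e \<in> edges G. kept e})
       (Pi_pmf (edges G) False (\<lambda>_. bernoulli_pmf p))"

end

theory Submission imports Defs begin

text \<open>
  Connectivity: bound the sum of \<open>(1 - p)\<^sup>x\<close> over all cuts, \<open>x\<close> being the size of the cut, by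
  contracting an edge and averaging over the choice of this edge. Cuts containing at most half of
  the edges survive such an average up to a factor absorbed in the exponent, and the others are
  negligible.

  Diameter: let \<open>L\<^sub>i\<close> be the vertices at distance \<open>i\<close> from a root in \<open>G\<close>, and \<open>U\<^sub>i\<close> those at
  distance at least \<open>i\<close>. Suppose that in the sampled graph every vertex of \<open>U\<^sub>i\<close> reaches \<open>L\<^sub>i\<close>
  inside \<open>U\<^sub>i\<close> within \<open>Y\<close> steps. Exploring from \<open>u\<close> inside \<open>U\<^sub>i\<close>, either the whole component of \<open>u\<close>
  is close to \<open>u\<close> and must be left through an edge to \<open>L\<^sub>i\<^sub>-\<^sub>1\<close>, the sampled graph being connected, or
  there are \<open>m\<close> vertices of \<open>L\<^sub>i\<close> within distance about \<open>2mY\<close>. Each of the latter has its own edge to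
  \<open>L\<^sub>i\<^sub>-\<^sub>1\<close>, which the exploration has not exposed, so for \<open>m\<close> about \<open>k / 4\<close> some of them is sampled
  with high probability. Hence the radius grows by a factor of about \<open>2m\<close> per level, which even
  gives the diameter bound \<open>k\<^sup>D\<close>.
\<close>

subsection \<open>Weighted sums over cuts\<close>

definition proper_cuts :: "'v set \<Rightarrow> 'v set set" where
  "proper_cuts V = {S. S \<subseteq> V \<and> S \<noteq> {} \<and> S \<noteq> V}"

text \<open>The endpoint map is a separate parameter so that a contraction keeps the edge set
  \<open>E\<close> and only replaces the map. Edges that a contraction turns into loops get a
  singleton image and never cross.\<close>

definition crossing :: "('e \<Rightarrow> 'v set) \<Rightarrow> 'e set \<Rightarrow> 'v set \<Rightarrow> 'e set" where
  "crossing \<phi> E S = {e \<in> E. \<phi> e \<inter> S \<noteq> {} \<and> \<not> \<phi> e \<subseteq> S}"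

lemma finite_proper_cuts: "finite V \<Longrightarrow> finite (proper_cuts V)"
  by (auto simp: proper_cuts_def)

lemma card_proper_cuts_le: "finite V \<Longrightarrow> card (proper_cuts V) \<le> 2 ^ card V"
  using card_mono[of "Pow V" "proper_cuts V"] by (auto simp: proper_cuts_def card_Pow)

lemma finite_crossing: "finite E \<Longrightarrow> finite (crossing \<phi> E S)"
  by (auto simp: crossing_def)

text \<open>Contracting \<open>e0\<close> merges \<open>b\<close> into \<open>a\<close>. A set that
  \<open>e0\<close> does not cross contains both or neither of them, so dropping \<open>b\<close>
  loses no information: membership of \<open>a\<close> tells whether \<open>b\<close> has to be put
  back.\<close>

lemma crossing_contract:
  fixes \<phi> :: "'e \<Rightarrow> 'v set"
  assumes "\<phi> e0 = {a, b}" "a \<noteq> b" "e0 \<in> E" "a \<in> V" "b \<in> V"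
  defines "f \<equiv> \<lambda>x. if x = b then a else x"
  shows "bij_betw (\<lambda>S. S - {b}) {S \<in> proper_cuts V. e0 \<notin> crossing \<phi> E S} (proper_cuts (V - {b}))"
    and "\<And>S. S \<in> proper_cuts V \<Longrightarrow> e0 \<notin> crossing \<phi> E S \<Longrightarrow>
           crossing (\<lambda>e. f ` \<phi> e) E (S - {b}) = crossing \<phi> E S"
proof -
  have same: "a \<in> S \<longleftrightarrow> b \<in> S" if "e0 \<notin> crossing \<phi> E S" for S
    using that assms(1,3) by (auto simp: crossing_def)
  show "bij_betw (\<lambda>S. S - {b}) {S \<in> proper_cuts V. e0 \<notin> crossing \<phi> E S} (proper_cuts (V - {b}))"
  proof (rule bij_betw_byWitness[where f' = "\<lambda>S. if a \<in> S then insert b S else S"])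
    show "\<forall>S\<in>{S \<in> proper_cuts V. e0 \<notin> crossing \<phi> E S}.
        (if a \<in> S - {b} then insert b (S - {b}) else S - {b}) = S"
      using same assms(2) by auto
    show "\<forall>S\<in>proper_cuts (V - {b}). (if a \<in> S then insert b S else S) - {b} = S"
      by (auto simp: proper_cuts_def)
    show "(\<lambda>S. S - {b}) ` {S \<in> proper_cuts V. e0 \<notin> crossing \<phi> E S} \<subseteq> proper_cuts (V - {b})"
    proof clarify
      fix S assume S: "S \<in> proper_cuts V" "e0 \<notin> crossing \<phi> E S"
      show "S - {b} \<in> proper_cuts (V - {b})"
        using S(1) same[OF S(2)] assms(2,4,5) unfolding proper_cuts_def by blast
    qed
    show "(\<lambda>S. if a \<in> S then insert b S else S) ` proper_cuts (V - {b})
      \<subseteq> {S \<in> proper_cuts V. e0 \<notin> crossing \<phi> E S}"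
    proof clarify
      fix S assume S: "S \<in> proper_cuts (V - {b})"
      then show "(if a \<in> S then insert b S else S) \<in> proper_cuts V \<and>
          e0 \<notin> crossing \<phi> E (if a \<in> S then insert b S else S)"
        using assms(1,2,3,4,5) unfolding proper_cuts_def crossing_def by auto
    qed
  qed
  show "crossing (\<lambda>e. f ` \<phi> e) E (S - {b}) = crossing \<phi> E S"
    if S: "S \<in> proper_cuts V" "e0 \<notin> crossing \<phi> E S" for S
  proof -
    have f: "f x \<in> S - {b} \<longleftrightarrow> x \<in> S" for x
      using same[OF S(2)] assms(2) by (auto simp: f_def)
    have "f ` A \<inter> (S - {b}) \<noteq> {} \<longleftrightarrow> A \<inter> S \<noteq> {}" "f ` A \<subseteq> S - {b} \<longleftrightarrow> A \<subseteq> S" for A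
      using f by blast+
    then show ?thesis unfolding crossing_def by presburger
  qed
qed

lemma crossing_card2:
  assumes "e \<in> crossing \<phi> E S" "finite (\<phi> e)" "card (\<phi> e) \<le> 2"
  shows "card (\<phi> e) = 2"
proof -
  obtain x y where "x \<in> \<phi> e" "x \<in> S" "y \<in> \<phi> e" "y \<notin> S"
    using assms(1) by (auto simp: crossing_def)
  then have "{x, y} \<subseteq> \<phi> e" "card {x, y} = 2" by (auto simp: card_2_iff)
  then have "2 \<le> card (\<phi> e)" using card_mono[OF assms(2)] by metis
  then show ?thesis using assms(3) by simp
qed

text \<open>With at least two vertices every singleton is a proper cut and so is crossed at least
  \<open>k\<close> times. Crossing edges are never loops, hence the double count needs only the
  edges with two ends.\<close>

lemma handshake_ge:
  assumes "finite V" "finite E" "card V \<ge> 2"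
    and "\<And>e. e \<in> E \<Longrightarrow> \<phi> e \<subseteq> V \<and> card (\<phi> e) \<le> 2"
    and "\<And>S. S \<in> proper_cuts V \<Longrightarrow> k \<le> card (crossing \<phi> E S)"
  shows "card V * k \<le> 2 * card {e \<in> E. card (\<phi> e) = 2}"
proof -
  let ?E2 = "{e \<in> E. card (\<phi> e) = 2}"
  have fin: "finite ?E2" using assms(2) by simp
  have "card V * k = (\<Sum>v\<in>V. k)" by simp
  also have "\<dots> \<le> (\<Sum>v\<in>V. card {e \<in> ?E2. v \<in> \<phi> e})"
  proof (rule sum_mono)
    fix v assume v: "v \<in> V"
    have "V \<noteq> {v}" using assms(3) by auto
    then have "{v} \<in> proper_cuts V" using v by (auto simp: proper_cuts_def)
    then have "k \<le> card (crossing \<phi> E {v})" using assms(5) by blast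
    also have "\<dots> \<le> card {e \<in> ?E2. v \<in> \<phi> e}"
    proof (rule card_mono)
      show "crossing \<phi> E {v} \<subseteq> {e \<in> ?E2. v \<in> \<phi> e}"
      proof
        fix e assume e: "e \<in> crossing \<phi> E {v}"
        then have "e \<in> E" "v \<in> \<phi> e" by (auto simp: crossing_def)
        moreover have "card (\<phi> e) = 2"
          using crossing_card2[OF e] assms(1,4) \<open>e \<in> E\<close> finite_subset by blast
        ultimately show "e \<in> {e \<in> ?E2. v \<in> \<phi> e}" by simp
      qed
    qed (use assms(2) in simp)
    finally show "k \<le> card {e \<in> ?E2. v \<in> \<phi> e}" .
  qed
  also have "\<dots> = (\<Sum>e\<in>?E2. card {v \<in> V. v \<in> \<phi> e})"
    using sum.swap_restrict[OF assms(1) fin, of "\<lambda>_ _. 1::nat" "\<lambda>v e. v \<in> \<phi> e"] by simp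
  also have "\<dots> = (\<Sum>e\<in>?E2. 2)"
  proof (rule sum.cong[OF refl])
    fix e assume "e \<in> ?E2"
    then have "{v \<in> V. v \<in> \<phi> e} = \<phi> e" "card (\<phi> e) = 2" using assms(4) by auto
    then show "card {v \<in> V. v \<in> \<phi> e} = 2" by simp
  qed
  also have "\<dots> = 2 * card ?E2" by simp
  finally show ?thesis .
qed

text \<open>For a cut with a fraction \<open>x\<close> of the edges, at most one half, this pays for
  the chance \<open>1 - x\<close> of surviving a random contraction by a small change of the
  exponent.\<close>

lemma exp_minus_double_le: "exp (- (2 * x)) \<le> 1 - x" if "0 \<le> x" "x \<le> 1/2" for x :: real
proof -
  have "- x - 2 * x\<^sup>2 \<le> ln (1 - x)" using ln_one_minus_pos_lower_bound[OF that] by simp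
  moreover have "2 * x\<^sup>2 \<le> x"
    using mult_right_mono[of "2 * x" 1 x] that by (simp add: power2_eq_square)
  ultimately have "- (2 * x) \<le> ln (1 - x)" by simp
  then have "exp (- (2 * x)) \<le> exp (ln (1 - x))" by simp
  then show ?thesis using that by simp
qed

text \<open>The first summand will stand for the large cuts, the second for the contracted graphs.
  Passing from \<open>Suc n\<close> to \<open>n\<close>, the fourth power gains a factor
  \<open>exp (- (4 / N))\<close>, while the lowered \<open>lam\<close> costs only
  \<open>exp (2 / N)\<close>; the difference leaves room for the large cuts.\<close>

lemma cut_sum_step_arith:
  fixes lam :: real and n :: nat
  assumes "n \<ge> 1" "lam \<ge> 8"
  shows "2 ^ Suc n * exp (- (lam * Suc n / 4)) + n ^ 4 * exp (- ((lam - 4 / Suc n) / 2))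
         \<le> Suc n ^ 4 * exp (- (lam / 2))"
proof -
  define N :: real where "N = Suc n"
  have N2: "N \<ge> 2" using assms by (simp add: N_def)
  have e1: "exp (- (lam / 4)) \<le> 1/2"
  proof -
    have "exp (- (lam/4)) \<le> exp (-1 :: real)" using assms by simp
    also have "exp (-1::real) \<le> 1/2"
      using exp_ge_add_one_self[of "1::real"] by (simp add: exp_minus field_simps)
    finally show ?thesis .
  qed
  \<comment> \<open>The base \<open>2 * exp (- (lam/4))\<close> is at most 1, so reducing the
    exponent from \<open>Suc n\<close> to 2 only increases the power.\<close>
  have "2 ^ Suc n * exp (- (lam * Suc n / 4)) = (2 * exp (- (lam/4))) ^ Suc n"
    by (simp only: power_mult_distrib exp_of_nat_mult[symmetric]) (simp add: field_simps)
  also have "\<dots> \<le> (2 * exp (- (lam/4))) ^ 2"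
    by (rule power_decreasing) (use assms e1 in auto)
  also have "\<dots> = 4 * exp (- (lam/2))"
    by (simp add: power_mult_distrib exp_of_nat_mult[symmetric])
  finally have A: "2 ^ Suc n * exp (- (lam * Suc n / 4)) \<le> 4 * exp (- (lam/2))" .
  have "exp (- ((lam - 4 / Suc n) / 2)) = exp (2 / N) * exp (- (lam/2))"
    unfolding exp_add[symmetric] N_def by (simp add: field_simps)
  moreover have "4 + real n ^ 4 * exp (2 / N) \<le> N ^ 4"
  proof -
    have "real n = N * (1 - 1 / N)" using N2 by (simp add: N_def field_simps)
    also have "\<dots> \<le> N * exp (- (1 / N))"
      using exp_ge_add_one_self[of "- (1/N)"] N2 by (intro mult_left_mono) auto
    finally have "real n ^ 4 \<le> (N * exp (- (1 / N))) ^ 4" by (intro power_mono) auto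
    also have "\<dots> = N ^ 4 * exp (- (4 / N))"
      by (simp add: power_mult_distrib exp_of_nat_mult[symmetric])
    finally have "real n ^ 4 * exp (2 / N) \<le> N ^ 4 * exp (- (4 / N)) * exp (2 / N)"
      by (intro mult_right_mono) auto
    also have "\<dots> = N ^ 4 * exp (- (2 / N))"
      unfolding mult.assoc exp_add[symmetric] by (simp add: field_simps)
    also have "\<dots> \<le> N ^ 4 * (N / (N + 2))"
    proof (intro mult_left_mono)
      have "1 + 2 / N \<le> exp (2 / N)" by (rule exp_ge_add_one_self)
      then have "inverse (exp (2 / N)) \<le> inverse (1 + 2 / N)"
        using N2 by (intro le_imp_inverse_le) (auto simp: add_pos_nonneg)
      also have "inverse (1 + 2 / N) = N / (N + 2)" using N2 by (simp add: field_simps)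
      finally show "exp (- (2 / N)) \<le> N / (N + 2)" by (simp add: exp_minus)
    qed (use N2 in auto)
    also have "\<dots> \<le> N ^ 4 - 4"
    proof -
      have "2 ^ 3 * N \<le> N ^ 3 * N" using N2 by (intro mult_right_mono power_mono) auto
      also have "\<dots> = N ^ 4" by (simp add: eval_nat_numeral)
      finally have "4 * (N + 2) \<le> 2 * N ^ 4" using N2 by simp
      then show ?thesis using N2 by (simp add: field_simps)
    qed
    finally show ?thesis by simp
  qed
  then have "(4 + real n ^ 4 * exp (2 / N)) * exp (- (lam/2)) \<le> N ^ 4 * exp (- (lam/2))"
    by (intro mult_right_mono) auto
  ultimately show ?thesis using A by (simp add: N_def algebra_simps)
qed

text \<open>The weight will bound the probability that no edge of the cut is sampled.
  \<open>lam\<close> varies in the induction because a contraction lowers it by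
  \<open>4 / N\<close>; these losses add up like a harmonic sum, which the summand
  \<open>4 * ln (card V)\<close> pays for. Images of size at most 2 admit the loops created on the
  way.\<close>

lemma cut_sum_bound:
  fixes \<phi> :: "'e \<Rightarrow> 'v set" and k :: nat
  assumes "finite V" "finite E" "k > 0" "V \<noteq> {}"
    and "\<And>e. e \<in> E \<Longrightarrow> \<phi> e \<subseteq> V \<and> card (\<phi> e) \<le> 2"
    and "\<And>S. S \<in> proper_cuts V \<Longrightarrow> k \<le> card (crossing \<phi> E S)"
    and "lam \<ge> 8 + 4 * ln (card V)"
  shows "(\<Sum>S\<in>proper_cuts V. exp (- (lam / k * card (crossing \<phi> E S)))) \<le> card V ^ 4 * exp (- (lam / 2))"
  using assms
proof (induction "card V - 1" arbitrary: V \<phi> lam)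
  case 0
  then obtain v where "V = {v}" by (metis card_1_singletonE card_gt_0_iff diff_is_0_eq le_antisym less_eq_Suc_le One_nat_def)
  then have "proper_cuts V = {}" by (auto simp: proper_cuts_def)
  then show ?case by simp
next
  case (Suc n0)
  define n where "n = card V - 1"
  have cV: "card V = Suc n" and n1: "n \<ge> 1" using Suc.hyps(2) by (auto simp: n_def)
  define N :: real where "N = Suc n"
  define m where "m = card {e \<in> E. card (\<phi> e) = 2}"
  define d where "d = (\<lambda>S. card (crossing \<phi> E S))"
  have N2: "N \<ge> 2" using n1 by (simp add: N_def)
  have lnN: "0 \<le> ln N" using N2 by simp
  have lam: "lam \<ge> 8 + 4 * ln N" using Suc.prems(7) cV by (simp add: N_def)
  have hs: "card V * k \<le> 2 * m"
    unfolding m_def using Suc.prems cV n1 by (intro handshake_ge) auto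
  then have hsr: "N * k \<le> 2 * real m" unfolding cV N_def by (metis of_nat_le_iff of_nat_mult of_nat_numeral)
  have Nk: "N * k > 0" using N2 Suc.prems(3) by simp
  then have m0: "real m > 0" using hsr by linarith
  have finC: "finite (proper_cuts V)" using Suc.prems(1) by (rule finite_proper_cuts)
  have crE2: "crossing \<phi> E S \<subseteq> {e \<in> E. card (\<phi> e) = 2}" for S
  proof
    fix e assume e: "e \<in> crossing \<phi> E S"
    then have "e \<in> E" by (auto simp: crossing_def)
    moreover have "card (\<phi> e) = 2"
      using crossing_card2[OF e] Suc.prems(1,5) \<open>e \<in> E\<close> finite_subset by blast
    ultimately show "e \<in> {e \<in> E. card (\<phi> e) = 2}" by simp
  qed
  have fE2: "finite {e \<in> E. card (\<phi> e) = 2}" using Suc.prems(2) by simp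
  have dm: "d S \<le> m" for S unfolding d_def m_def by (rule card_mono[OF fE2 crE2])
  \<comment> \<open>The weights for \<open>lam\<close> and \<open>lam'\<close> then differ by the
    factor \<open>exp (- (4 * d S / (N * k)))\<close>, which is at most
    \<open>exp (- (2 * d S / m))\<close> since \<open>N * k \<le> 2 * m\<close>.\<close>
  define lam' where "lam' = lam - 4 / N"
  let ?g = "\<lambda>l S. exp (- (l / k * d S))"
  let ?sm = "{S \<in> proper_cuts V. 2 * d S \<le> m}"
  let ?lg = "{S \<in> proper_cuts V. \<not> 2 * d S \<le> m}"

  \<comment> \<open>A cut with more than half of the edges has at least \<open>N * k / 4\<close> of
    them, so bounding the number of such cuts by that of all vertex sets is affordable.\<close>
  have large: "sum (?g lam) ?lg \<le> 2 ^ Suc n * exp (- (lam * Suc n / 4))"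
  proof -
    have "sum (?g lam) ?lg \<le> (\<Sum>S\<in>?lg. exp (- (lam * Suc n / 4)))"
    proof (rule sum_mono)
      fix S assume "S \<in> ?lg"
      then have "real m \<le> 2 * d S" by simp
      then have "N * k / 4 \<le> d S" using hsr by simp
      then have "lam / k * (N * k / 4) \<le> lam / k * d S"
        using lam lnN by (intro mult_left_mono) auto
      moreover have "lam / k * (N * k / 4) = lam * N / 4" using Suc.prems(3) by simp
      ultimately show "?g lam S \<le> exp (- (lam * Suc n / 4))" by (simp add: N_def)
    qed
    also have "\<dots> = card ?lg * exp (- (lam * Suc n / 4))" by simp
    also have "\<dots> \<le> 2 ^ Suc n * exp (- (lam * Suc n / 4))"
    proof (rule mult_right_mono)
      have "card ?lg \<le> card (proper_cuts V)" by (rule card_mono[OF finC]) auto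
      also have "\<dots> \<le> 2 ^ Suc n" using card_proper_cuts_le[OF Suc.prems(1)] cV by simp
      finally have "card ?lg \<le> 2 ^ Suc n" .
      then have "real (card ?lg) \<le> real (2 ^ Suc n)" by (rule of_nat_mono)
      then show "real (card ?lg) \<le> 2 ^ Suc n" by simp
    qed simp
    finally show ?thesis .
  qed

  \<comment> \<open>\<open>ln N - ln n\<close> is at least \<open>1 / N\<close>, so the logarithmic
    summand falls by at least as much as \<open>lam\<close> does.\<close>
  have lam'_ge: "lam' \<ge> 8 + 4 * ln n"
  proof -
    have "ln (real n / N) \<le> real n / N - 1" using n1 N2 by (intro ln_le_minus_one) auto
    then have "ln n - ln N \<le> - (1 / N)" using n1 N2 by (simp add: ln_div N_def field_simps)
    then show ?thesis using lam by (simp add: lam'_def)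
  qed

  \<comment> \<open>The cuts that \<open>e0\<close> does not cross are, with the same crossing
    edges, all the cuts of the graph contracted along \<open>e0\<close>, where the induction
    hypothesis applies.\<close>
  have contr: "(\<Sum>S | S \<in> proper_cuts V \<and> e0 \<notin> crossing \<phi> E S. ?g lam' S) \<le> n ^ 4 * exp (- (lam' / 2))"
    if e0: "e0 \<in> E" "card (\<phi> e0) = 2" for e0
  proof -
    obtain a b where ab: "\<phi> e0 = {a, b}" "a \<noteq> b" using e0(2) by (auto simp: card_2_iff)
    have abV: "a \<in> V" "b \<in> V" using Suc.prems(5)[OF e0(1)] ab by auto
    define f where "f = (\<lambda>x. if x = b then a else x)"
    define \<phi>' where "\<phi>' = (\<lambda>e. f ` \<phi> e)"
    have subV: "\<And>e. e \<in> E \<Longrightarrow> \<phi> e \<subseteq> V" using Suc.prems(5) by blast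
    note cc = crossing_contract[of \<phi>, OF ab e0(1) abV, folded f_def, folded \<phi>'_def]
    have "(\<Sum>S | S \<in> proper_cuts V \<and> e0 \<notin> crossing \<phi> E S. ?g lam' S)
        = (\<Sum>S | S \<in> proper_cuts V \<and> e0 \<notin> crossing \<phi> E S.
             exp (- (lam' / k * card (crossing \<phi>' E (S - {b})))))"
      by (rule sum.cong) (auto simp: d_def cc(2))
    also have "\<dots> = (\<Sum>S\<in>proper_cuts (V - {b}). exp (- (lam' / k * card (crossing \<phi>' E S))))"
      by (rule sum.reindex_bij_betw[OF cc(1)])
    also have "\<dots> \<le> card (V - {b}) ^ 4 * exp (- (lam' / 2))"
    proof (rule Suc.hyps(1))
      show "n0 = card (V - {b}) - 1" using Suc.hyps(2) abV by simp
      show "V - {b} \<noteq> {}" using ab abV by auto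
      show "\<phi>' e \<subseteq> V - {b} \<and> card (\<phi>' e) \<le> 2" if "e \<in> E" for e
      proof
        show "\<phi>' e \<subseteq> V - {b}" using subV[OF that] ab abV by (auto simp: \<phi>'_def f_def)
        show "card (\<phi>' e) \<le> 2" unfolding \<phi>'_def
          using card_image_le[of "\<phi> e" f] Suc.prems(1,5) that finite_subset le_trans by metis
      qed
      show "k \<le> card (crossing \<phi>' E S)" if "S \<in> proper_cuts (V - {b})" for S
      proof -
        have "S \<in> (\<lambda>S. S - {b}) ` {S \<in> proper_cuts V. e0 \<notin> crossing \<phi> E S}"
          using that bij_betw_imp_surj_on[OF cc(1)] by simp
        then obtain S0 where S0: "S0 \<in> proper_cuts V" "e0 \<notin> crossing \<phi> E S0" "S = S0 - {b}"
          by blast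
        show ?thesis using Suc.prems(6)[OF S0(1)] unfolding S0(3) cc(2)[OF S0(1,2)] .
      qed
      show "8 + 4 * ln (real (card (V - {b}))) \<le> lam'" using lam'_ge abV cV by simp
    qed (use Suc.prems in auto)
    finally show ?thesis using abV cV by simp
  qed

  \<comment> \<open>The average over the contracted edge, multiplied by \<open>m\<close>: exactly
    \<open>m - d S\<close> of the \<open>m\<close> edges with two ends can be contracted without
    destroying \<open>S\<close>.\<close>
  have "m * (\<Sum>S\<in>?sm. ?g lam S) \<le> (\<Sum>S\<in>?sm. real (m - d S) * ?g lam' S)"
    unfolding sum_distrib_left
  proof (rule sum_mono)
    fix S assume "S \<in> ?sm"
    then have small: "2 * d S \<le> m" by simp
    define x where "x = d S / real m"
    have "exp (- (4 * d S / (N * k))) \<le> exp (- (2 * x))"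
    proof -
      have "2 * x = 4 * d S / (2 * m)" by (simp add: x_def)
      also have "\<dots> \<le> 4 * d S / (N * k)" using hsr Nk by (intro divide_left_mono) (auto simp: m0)
      finally show ?thesis by simp
    qed
    also have "\<dots> \<le> 1 - x"
      by (rule exp_minus_double_le) (use small m0 in \<open>auto simp: x_def field_simps simp flip: of_nat_mult\<close>)
    finally have "m * exp (- (4 * d S / (N * k))) \<le> m * (1 - x)" by (rule mult_left_mono) simp
    also have "m * (1 - x) = real (m - d S)" using m0 dm[of S] by (simp add: x_def field_simps of_nat_diff)
    finally have "m * exp (- (4 * d S / (N * k))) * ?g lam' S \<le> real (m - d S) * ?g lam' S"
      by (rule mult_right_mono) simp
    moreover have "exp (- (4 * d S / (N * k))) * ?g lam' S = ?g lam S"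
      unfolding exp_add[symmetric] lam'_def by (simp add: algebra_simps diff_divide_distrib)
    ultimately show "m * ?g lam S \<le> real (m - d S) * ?g lam' S" by (simp only: mult.assoc)
  qed
  also have "\<dots> \<le> (\<Sum>S\<in>proper_cuts V. real (m - d S) * ?g lam' S)"
    by (rule sum_mono2[OF finC]) auto
  also have "\<dots> = (\<Sum>S\<in>proper_cuts V. \<Sum>e | e \<in> {e \<in> E. card (\<phi> e) = 2} \<and> e \<notin> crossing \<phi> E S. ?g lam' S)"
  proof (rule sum.cong[OF refl])
    fix S
    have "{e. e \<in> {e \<in> E. card (\<phi> e) = 2} \<and> e \<notin> crossing \<phi> E S} = {e \<in> E. card (\<phi> e) = 2} - crossing \<phi> E S"
      by auto
    then have "card {e. e \<in> {e \<in> E. card (\<phi> e) = 2} \<and> e \<notin> crossing \<phi> E S} = m - d S"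
      unfolding m_def d_def
      by (simp only: card_Diff_subset[OF finite_crossing[OF Suc.prems(2)] crE2])
    then show "real (m - d S) * ?g lam' S = (\<Sum>e | e \<in> {e \<in> E. card (\<phi> e) = 2} \<and> e \<notin> crossing \<phi> E S. ?g lam' S)"
      by simp
  qed
  also have "\<dots> = (\<Sum>e\<in>{e \<in> E. card (\<phi> e) = 2}. \<Sum>S | S \<in> proper_cuts V \<and> e \<notin> crossing \<phi> E S. ?g lam' S)"
    by (rule sum.swap_restrict[OF finC fE2])
  also have "\<dots> \<le> (\<Sum>e\<in>{e \<in> E. card (\<phi> e) = 2}. n ^ 4 * exp (- (lam' / 2)))"
    using contr by (intro sum_mono) auto
  also have "\<dots> = m * (n ^ 4 * exp (- (lam' / 2)))" by (simp add: m_def)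
  finally have "sum (?g lam) ?sm \<le> n ^ 4 * exp (- (lam' / 2))" using m0 by simp
  moreover have "sum (?g lam) (proper_cuts V) = sum (?g lam) ?lg + sum (?g lam) ?sm"
    using sum.Int_Diff[OF finC, of "?g lam" "{S. \<not> 2 * d S \<le> m}"]
    by (simp add: Int_def set_diff_eq)
  ultimately have "sum (?g lam) (proper_cuts V)
     \<le> 2 ^ Suc n * exp (- (lam * Suc n / 4)) + n ^ 4 * exp (- ((lam - 4 / Suc n) / 2))"
    using large by (simp add: lam'_def N_def)
  also have "\<dots> \<le> Suc n ^ 4 * exp (- (lam / 2))"
    using cut_sum_step_arith[OF n1] lam lnN by simp
  finally show ?case unfolding d_def cV .
qed

subsection \<open>Connectivity of the sampled graph\<close>

lemma prob_absent_edges: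
  assumes "finite E" "A \<subseteq> E" "0 \<le> p" "p \<le> 1"
  shows "measure_pmf.prob (Pi_pmf E False (\<lambda>_. bernoulli_pmf p)) {\<omega>. \<forall>e\<in>A. \<not> \<omega> e} = (1 - p) ^ card A"
proof -
  let ?B = "\<lambda>e. if e \<in> A then {False} else UNIV"
  have "{\<omega>. \<forall>e\<in>A. \<not> \<omega> e} = Pi E ?B" using assms(2) by (auto simp: Pi_def split: if_splits)
  then have "measure_pmf.prob (Pi_pmf E False (\<lambda>_. bernoulli_pmf p)) {\<omega>. \<forall>e\<in>A. \<not> \<omega> e}
      = (\<Prod>e\<in>E. measure_pmf.prob (bernoulli_pmf p) (?B e))"
    using measure_Pi_pmf_Pi[OF assms(1)] by simp
  also have "\<dots> = (\<Prod>e\<in>E. if e \<in> A then 1 - p else 1)"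
    using assms(3,4) by (intro prod.cong) (auto simp: measure_pmf_single)
  also have "\<dots> = (1 - p) ^ card A"
    using assms(1,2) by (simp add: prod.If_cases Int_absorb1)
  finally show ?thesis .
qed

text \<open>Deferred decisions: the coordinates in \<open>F\<close> determine \<open>W\<close>, and
  \<open>W\<close> lies outside \<open>F\<close>. Once those coordinates are fixed, the edges of
  \<open>W\<close> form a fixed set that is still sampled independently.\<close>

lemma prob_exposed_absent_edges_le:
  fixes W :: "('e \<Rightarrow> bool) \<Rightarrow> 'e set"
  assumes "finite E" "F \<subseteq> E" "0 \<le> p" "p \<le> 1"
    and dep: "\<And>\<omega> \<omega>'. (\<forall>e\<in>F. \<omega> e = \<omega>' e) \<Longrightarrow> W \<omega> = W \<omega>'"
    and sub: "\<And>\<omega>. W \<omega> \<subseteq> E - F"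
  shows "measure_pmf.prob (Pi_pmf E False (\<lambda>_. bernoulli_pmf p))
           {\<omega>. m \<le> card (W \<omega>) \<and> (\<forall>e\<in>W \<omega>. \<not> \<omega> e)} \<le> (1 - p) ^ m"
proof -
  let ?P = "\<lambda>A. Pi_pmf A False (\<lambda>_. bernoulli_pmf p)"
  let ?X = "{\<omega>. m \<le> card (W \<omega>) \<and> (\<forall>e\<in>W \<omega>. \<not> \<omega> e)}"
  let ?h = "\<lambda>f g e. if e \<in> F then f e else g e"
  have fin: "finite F" "finite (E - F)" using assms(1,2) finite_subset by auto
  have "?P E = ?P (F \<union> (E - F))" using assms(2) by (simp add: Un_absorb1)
  also have "\<dots> = map_pmf (\<lambda>(f, g). ?h f g) (pair_pmf (?P F) (?P (E - F)))"
    by (rule Pi_pmf_union[OF fin]) auto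
  also have "\<dots> = bind_pmf (?P F) (\<lambda>f. map_pmf (?h f) (?P (E - F)))"
    by (simp add: pair_pmf_def map_bind_pmf map_pmf_def bind_assoc_pmf bind_return_pmf)
  finally have "emeasure (?P E) ?X = (\<integral>\<^sup>+f. emeasure (map_pmf (?h f) (?P (E - F))) ?X \<partial>?P F)"
    by simp
  also have "\<dots> \<le> (\<integral>\<^sup>+f. ennreal ((1 - p) ^ m) \<partial>?P F)"
  proof (rule nn_integral_mono)
    fix f
    have W: "W (?h f g) = W f" for g by (rule dep) simp
    have abs: "(\<forall>e\<in>W f. \<not> ?h f g e) \<longleftrightarrow> (\<forall>e\<in>W f. \<not> g e)" for g using sub[of f] by auto
    have "measure_pmf.prob (map_pmf (?h f) (?P (E - F))) ?X \<le> (1 - p) ^ m"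
    proof (cases "m \<le> card (W f)")
      case True
      have "?h f -` ?X = {g. \<forall>e\<in>W f. \<not> g e}" using True by (simp add: vimage_def W abs)
      then have "measure_pmf.prob (map_pmf (?h f) (?P (E - F))) ?X = (1 - p) ^ card (W f)"
        using prob_absent_edges[OF fin(2) sub assms(3,4)] by simp
      also have "\<dots> \<le> (1 - p) ^ m" using assms(3,4) True by (intro power_decreasing) auto
      finally show ?thesis .
    next
      case False
      then have "?h f -` ?X = {}" by (simp add: vimage_def W)
      then show ?thesis using assms(4) by (simp only: measure_map_pmf measure_empty) simp
    qed
    then show "emeasure (map_pmf (?h f) (?P (E - F))) ?X \<le> ennreal ((1 - p) ^ m)"
      unfolding measure_pmf.emeasure_eq_measure by (rule ennreal_leI)
  qed
  also have "\<dots> = ennreal ((1 - p) ^ m)" by simp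
  finally show ?thesis
    using assms(4) unfolding measure_pmf.emeasure_eq_measure by simp
qed

section \<open>Connectedness in terms of cuts\<close>

lemma fin_multigraph_spanning_subgraph:
  "fin_multigraph G \<Longrightarrow> F \<subseteq> edges G \<Longrightarrow> fin_multigraph (spanning_subgraph G F)"
  unfolding fin_multigraph_def spanning_subgraph_def using finite_subset by auto

lemma (in fin_multigraph) adj_verts: "(u, v) \<in> adj G \<Longrightarrow> u \<in> verts G \<and> v \<in> verts G"
  using ends_subset by (fastforce simp: adj_def)

lemma sym_adj: "sym (adj G)"
  by (auto simp: sym_def adj_def insert_commute)

text \<open>A walk leaving \<open>S\<close> has to use a crossing edge. Conversely, a component that
  misses some vertex is a proper cut without crossing edges.\<close>

lemma (in fin_multigraph) graph_connected_iff_crossing: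
  "graph_connected G \<longleftrightarrow> (\<forall>S\<in>proper_cuts (verts G). crossing (ends G) (edges G) S \<noteq> {})"
proof
  assume conn: "graph_connected G"
  show "\<forall>S\<in>proper_cuts (verts G). crossing (ends G) (edges G) S \<noteq> {}"
  proof
    fix S assume "S \<in> proper_cuts (verts G)"
    then obtain u v where uv: "u \<in> S" "v \<in> verts G" "v \<notin> S" "u \<in> verts G"
      unfolding proper_cuts_def by blast
    have "(u, v) \<in> (adj G)\<^sup>*" using conn uv by (auto simp: graph_connected_def)
    then have "\<exists>x y. (x, y) \<in> adj G \<and> x \<in> S \<and> y \<notin> S"
      using uv(3) by (induction rule: rtrancl_induct) (use uv(1) in blast)+
    then obtain x y where xy: "(x, y) \<in> adj G" "x \<in> S" "y \<notin> S" by blast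
    then obtain e where "e \<in> edges G" "ends G e = {x, y}" by (auto simp: adj_def)
    then have "e \<in> crossing (ends G) (edges G) S" using xy by (auto simp: crossing_def)
    then show "crossing (ends G) (edges G) S \<noteq> {}" by blast
  qed
next
  assume cr: "\<forall>S\<in>proper_cuts (verts G). crossing (ends G) (edges G) S \<noteq> {}"
  show "graph_connected G"
  proof (rule ccontr)
    assume "\<not> graph_connected G"
    then obtain u v where uv: "u \<in> verts G" "v \<in> verts G" "(u, v) \<notin> (adj G)\<^sup>*"
      by (auto simp: graph_connected_def)
    define S where "S = {x \<in> verts G. (u, x) \<in> (adj G)\<^sup>*}"
    have "S \<in> proper_cuts (verts G)" using uv by (auto simp: proper_cuts_def S_def)
    then obtain e where e: "e \<in> edges G" "ends G e \<inter> S \<noteq> {}" "\<not> ends G e \<subseteq> S"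
      using cr by (fastforce simp: crossing_def)
    then obtain x y where xy: "x \<in> ends G e" "y \<in> ends G e" "x \<in> S" "y \<notin> S" by blast
    then have "{x, y} = ends G e"
      using card_ends[OF e(1)] by (intro card_seteq) (auto intro: card_ge_0_finite simp: card_insert_if)
    then have "(x, y) \<in> adj G" using e(1) by (auto simp: adj_def)
    then have "y \<in> S" using xy(3) adj_verts by (auto simp: S_def intro: rtrancl_into_rtrancl)
    then show False using xy(4) by blast
  qed
qed

lemma (in fin_multigraph) graph_connected_spanning_iff:
  assumes "F \<subseteq> edges G"
  shows "graph_connected (spanning_subgraph G F) \<longleftrightarrow>
    (\<forall>S\<in>proper_cuts (verts G). crossing (ends G) F S \<noteq> {})"
proof -
  interpret H: fin_multigraph "spanning_subgraph G F"
    using fin_multigraph_spanning_subgraph[OF fin_multigraph_axioms assms] .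
  show ?thesis using H.graph_connected_iff_crossing by (simp add: spanning_subgraph_def)
qed

text \<open>Deleting every edge across \<open>S\<close> disconnects the graph, which
  \<open>k - 1\<close> deletions cannot do.\<close>

lemma (in fin_multigraph) k_edge_connected_crossing:
  assumes "k_edge_connected k G" "S \<in> proper_cuts (verts G)"
  shows "k \<le> card (crossing (ends G) (edges G) S)"
proof (rule ccontr)
  let ?F = "crossing (ends G) (edges G) S"
  assume "\<not> ?thesis"
  then have "graph_connected (spanning_subgraph G (edges G - ?F))"
    using assms(1) unfolding k_edge_connected_def by (auto simp: crossing_def)
  then have "crossing (ends G) (edges G - ?F) S \<noteq> {}"
    using graph_connected_spanning_iff assms(2) by blast
  then show False by (auto simp: crossing_def)
qed

text \<open>A disconnected sample leaves some cut without edges. The union bound over cuts becomes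
  the weighted sum of \<open>cut_sum_bound\<close>, because
  \<open>1 - p \<le> exp (- (lam / k))\<close>.\<close>

lemma (in fin_multigraph) prob_disconnected_le:
  assumes "k_edge_connected k G" "k > 0" "verts G \<noteq> {}"
    and lam: "lam \<ge> 8 + 4 * ln (card (verts G))" "lam / k \<le> p" "p \<le> 1"
  shows "measure_pmf.prob (Pi_pmf (edges G) False (\<lambda>_. bernoulli_pmf p))
           {\<omega>. \<not> graph_connected (spanning_subgraph G {e \<in> edges G. \<omega> e})}
         \<le> card (verts G) ^ 4 * exp (- (lam / 2))"
proof -
  let ?M = "Pi_pmf (edges G) False (\<lambda>_. bernoulli_pmf p)"
  let ?cr = "crossing (ends G) (edges G)"
  let ?C = "proper_cuts (verts G)"
  have "card (verts G) > 0" using assms(3) finite_verts by (simp add: card_gt_0_iff)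
  then have "0 \<le> ln (card (verts G))" by simp
  then have "0 \<le> lam / k" using lam by simp
  then have p0: "0 \<le> p" using lam(2) by linarith
  have "crossing (ends G) {e \<in> edges G. \<omega> e} S = {} \<longleftrightarrow> (\<forall>e\<in>?cr S. \<not> \<omega> e)" for \<omega> S
    by (auto simp: crossing_def)
  then have "{\<omega>. \<not> graph_connected (spanning_subgraph G {e \<in> edges G. \<omega> e})}
      = (\<Union>S\<in>?C. {\<omega>. \<forall>e\<in>?cr S. \<not> \<omega> e})"
    by (auto simp: graph_connected_spanning_iff)
  then have "measure_pmf.prob ?M {\<omega>. \<not> graph_connected (spanning_subgraph G {e \<in> edges G. \<omega> e})}
      \<le> (\<Sum>S\<in>?C. measure_pmf.prob ?M {\<omega>. \<forall>e\<in>?cr S. \<not> \<omega> e})"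
    using measure_pmf.finite_measure_subadditive_finite[OF finite_proper_cuts[OF finite_verts]] by simp
  also have "\<dots> \<le> (\<Sum>S\<in>?C. exp (- (lam / k * card (?cr S))))"
  proof (rule sum_mono)
    fix S
    have "measure_pmf.prob ?M {\<omega>. \<forall>e\<in>?cr S. \<not> \<omega> e} = (1 - p) ^ card (?cr S)"
      using p0 lam(3) finite_edges by (intro prob_absent_edges) (auto simp: crossing_def)
    also have "\<dots> \<le> exp (- (lam / k)) ^ card (?cr S)"
    proof (rule power_mono)
      show "1 - p \<le> exp (- (lam / k))"
        using exp_ge_add_one_self[of "- (lam / k)"] lam(2) by linarith
    qed (use lam in simp)
    also have "\<dots> = exp (- (lam / k * card (?cr S)))"
      by (simp add: exp_of_nat_mult[symmetric] mult.commute)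
    finally show "measure_pmf.prob ?M {\<omega>. \<forall>e\<in>?cr S. \<not> \<omega> e} \<le> exp (- (lam / k * card (?cr S)))" .
  qed
  also have "\<dots> \<le> card (verts G) ^ 4 * exp (- (lam / 2))"
    by (rule cut_sum_bound) (use assms finite_verts finite_edges ends_subset card_ends
          k_edge_connected_crossing in auto)
  finally show ?thesis .
qed

subsection \<open>Descending through the levels of a breadth-first search\<close>

definition near :: "('v \<times> 'v) set \<Rightarrow> nat \<Rightarrow> 'v \<Rightarrow> 'v set" where
  "near A r u = {w. \<exists>l\<le>r. (u, w) \<in> A ^^ l}"

lemma near_refl: "u \<in> near A r u"
  by (auto simp: near_def intro: exI[of _ 0])

lemma near_step: "w \<in> near A r u \<Longrightarrow> (w, x) \<in> A \<Longrightarrow> x \<in> near A (Suc r) u"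
  unfolding near_def by (blast intro: relpow_Suc_I Suc_le_mono[THEN iffD2])

lemma near_trans:
  assumes "w \<in> near A r u" "x \<in> near A s w"
  shows "x \<in> near A (r + s) u"
proof -
  obtain l l' where "l \<le> r" "(u, w) \<in> A ^^ l" "l' \<le> s" "(w, x) \<in> A ^^ l'"
    using assms by (auto simp: near_def)
  then have "l + l' \<le> r + s" "(u, x) \<in> A ^^ (l + l')" by (auto simp: relpow_add)
  then show ?thesis by (auto simp: near_def)
qed

lemma near_mono:
  assumes "A \<subseteq> B" "r \<le> s"
  shows "near A r u \<subseteq> near B s u"
proof -
  have "A ^^ l \<subseteq> B ^^ l" for l using assms(1) by (induction l) auto
  then show ?thesis unfolding near_def using assms(2) by (blast intro: order_trans)
qed

lemma near_sym:
  assumes "sym A" "w \<in> near A r u"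
  shows "u \<in> near A r w"
proof -
  have "(y, x) \<in> A ^^ l" if "(x, y) \<in> A ^^ l" for x y l
    using that
  proof (induction l arbitrary: y)
    case (Suc l)
    then obtain z where "(x, z) \<in> A ^^ l" "(z, y) \<in> A" by auto
    then have "(z, x) \<in> A ^^ l" "(y, z) \<in> A" using Suc.IH assms(1) by (auto dest: symD)
    then show ?case by (rule relpow_Suc_I2[rotated])
  qed simp
  then show ?thesis using assms(2) by (auto simp: near_def)
qed

lemma near_imp_rtrancl: "w \<in> near A r u \<Longrightarrow> (u, w) \<in> A\<^sup>*"
  by (auto simp: near_def intro: relpow_imp_rtrancl)

text \<open>On a shortest walk from \<open>u\<close> to the far vertex \<open>y\<close>, take the
  vertices at distance \<open>j * (2 * Y + 1)\<close> for \<open>j < m\<close>. Their balls of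
  radius \<open>Y\<close> are pairwise disjoint, and each of them meets \<open>L\<close>.\<close>

lemma many_near_or_all_near:
  assumes "sym A" "finite L"
    and cover: "\<And>x. (u, x) \<in> A\<^sup>* \<Longrightarrow> near A Y x \<inter> L \<noteq> {}"
    and far: "(u, y) \<in> A\<^sup>*" "y \<notin> near A ((m - 1) * (2 * Y + 1)) u"
  shows "m \<le> card (near A ((m - 1) * (2 * Y + 1) + Y) u \<inter> L)"
proof -
  define s where "s = 2 * Y + 1"
  have "\<exists>x. (u, x) \<in> A ^^ (j * s) \<and> (\<forall>l<j * s. (u, x) \<notin> A ^^ l)" if j: "j < m" for j
  proof -
    \<comment> \<open>The vertex after \<open>j * s\<close> steps of a shortest walk to
      \<open>y\<close> works: a quicker way to it would shorten that walk.\<close>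
    define d where "d = (LEAST l. (u, y) \<in> A ^^ l)"
    obtain l0 where "(u, y) \<in> A ^^ l0" using far(1) by (auto simp: rtrancl_power)
    then have d: "(u, y) \<in> A ^^ d" unfolding d_def by (rule LeastI)
    have "j * s \<le> (m - 1) * s" using j by (intro mult_le_mono) auto
    moreover have "\<not> d \<le> (m - 1) * s" using far(2) d by (auto simp: near_def s_def)
    ultimately have js: "j * s \<le> d" by linarith
    then have "(u, y) \<in> A ^^ (j * s) O A ^^ (d - j * s)" using d by (simp flip: relpow_add)
    then obtain x where x: "(u, x) \<in> A ^^ (j * s)" "(x, y) \<in> A ^^ (d - j * s)" by blast
    have "(u, x) \<notin> A ^^ l" if "l < j * s" for l
    proof
      assume "(u, x) \<in> A ^^ l"
      then have "(u, y) \<in> A ^^ (l + (d - j * s))" using x(2) by (auto simp: relpow_add)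
      then have "d \<le> l + (d - j * s)" unfolding d_def by (rule Least_le)
      then show False using that js by simp
    qed
    then show ?thesis using x(1) by blast
  qed
  then obtain x where x: "\<And>j. j < m \<Longrightarrow> (u, x j) \<in> A ^^ (j * s)"
    and xmin: "\<And>j l. j < m \<Longrightarrow> l < j * s \<Longrightarrow> (u, x j) \<notin> A ^^ l" by metis
  have xnear: "x j \<in> near A (j * s) u" if "j < m" for j using x[OF that] by (auto simp: near_def)
  have "\<exists>w. w \<in> near A Y (x j) \<inter> L" if "j < m" for j
    using cover[OF near_imp_rtrancl[OF xnear[OF that]]] by blast
  then obtain w where w: "\<And>j. j < m \<Longrightarrow> w j \<in> near A Y (x j) \<inter> L" by metis
  \<comment> \<open>If the two choices agreed, \<open>x j\<close> would be reached from
    \<open>x i\<close> in \<open>2 * Y\<close> steps, one less than the spacing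
    \<open>s\<close>.\<close>
  have neq: "w i \<noteq> w j" if "i < j" "j < m" for i j
  proof
    assume eq: "w i = w j"
    have "w i \<in> near A (i * s + Y) u" using near_trans[OF xnear[of i]] w[of i] that by auto
    moreover have "x j \<in> near A Y (w i)" using near_sym[OF assms(1)] w[of j] that eq by auto
    ultimately have "x j \<in> near A (i * s + Y + Y) u" by (rule near_trans)
    then obtain l where l: "l \<le> i * s + Y + Y" "(u, x j) \<in> A ^^ l" by (auto simp: near_def)
    have "Suc i * s \<le> j * s" using that(1) by (intro mult_le_mono) auto
    then have "l < j * s" using l(1) by (simp add: s_def)
    then show False using xmin[OF that(2)] l(2) by blast
  qed
  then have "inj_on w {..<m}" by (auto simp: inj_on_def) (metis linorder_neqE_nat)
  then have "m = card (w ` {..<m})" by (simp add: card_image)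
  also have "\<dots> \<le> card (near A ((m - 1) * (2 * Y + 1) + Y) u \<inter> L)"
  proof (rule card_mono)
    show "w ` {..<m} \<subseteq> near A ((m - 1) * (2 * Y + 1) + Y) u \<inter> L"
    proof clarify
      fix j assume j: "j < m"
      have "w j \<in> near A (j * s + Y) u" using near_trans[OF xnear] w j by blast
      moreover have "j * s + Y \<le> (m - 1) * (2 * Y + 1) + Y"
        unfolding s_def using j by (intro add_mono mult_le_mono) auto
      ultimately show "w j \<in> near A ((m - 1) * (2 * Y + 1) + Y) u \<inter> L"
        using w[OF j] near_mono[OF subset_refl] by (metis IntD2 IntI in_mono)
    qed
  qed (use assms(2) in simp)
  finally show ?thesis .
qed

section \<open>Descent by one level\<close>

definition upper :: "('v \<Rightarrow> nat) \<Rightarrow> nat \<Rightarrow> ('v \<times> 'v) set \<Rightarrow> ('v \<times> 'v) set" where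
  "upper lev i C = {(x, y) \<in> C. i \<le> lev x \<and> i \<le> lev y}"

lemma sym_upper: "sym C \<Longrightarrow> sym (upper lev i C)"
  by (auto simp: sym_def upper_def)

lemma upper_rtrancl_level:
  "(u, x) \<in> (upper lev i C)\<^sup>* \<Longrightarrow> i \<le> lev u \<Longrightarrow> i \<le> lev x"
  by (induction rule: rtrancl_induct) (auto simp: upper_def)

text \<open>Consider the component of \<open>u\<close> within the levels from \<open>Suc j\<close>
  on. If it extends beyond radius \<open>(m - 1) * (2 * Y + 1)\<close>, it supplies the
  \<open>m\<close> vertices that \<open>good\<close> asks for; otherwise all of it is near, and a
  walk to the root must leave it. Randomness will enter only through \<open>good\<close> and the
  connection to the root.\<close>

lemma descend_one_level:
  fixes C :: "('v \<times> 'v) set" and lev :: "'v \<Rightarrow> nat"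
  assumes "sym C" "finite V" "C \<subseteq> V \<times> V" "m > 0"
    and lev_step: "\<And>x y. (x, y) \<in> C \<Longrightarrow> lev y \<le> Suc (lev x)"
    and root: "lev r = 0" "\<And>u. u \<in> V \<Longrightarrow> (u, r) \<in> C\<^sup>*"
    and IH: "\<And>u. u \<in> V \<Longrightarrow> Suc j \<le> lev u \<Longrightarrow> \<exists>w\<in>near (upper lev (Suc j) C) Y u. lev w = Suc j"
    and good: "\<And>u. u \<in> V \<Longrightarrow>
        m \<le> card (near (upper lev (Suc j) C) ((m - 1) * (2 * Y + 1) + Y) u \<inter> {w \<in> V. lev w = Suc j}) \<Longrightarrow>
        \<exists>w\<in>near (upper lev (Suc j) C) ((m - 1) * (2 * Y + 1) + Y) u. \<exists>w'.
          lev w = Suc j \<and> (w, w') \<in> C \<and> lev w' = j"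
    and u: "u \<in> V" "j \<le> lev u"
  shows "\<exists>w\<in>near (upper lev j C) ((2 * m - 1) * Y + m) u. lev w = j"
proof (cases "lev u = j")
  case True
  then show ?thesis by (rule bexI[OF _ near_refl])
next
  case False
  then have uj: "Suc j \<le> lev u" using u(2) by simp
  let ?A = "upper lev (Suc j) C" and ?R = "(m - 1) * (2 * Y + 1)"
  have AC: "?A \<subseteq> upper lev j C" by (auto simp: upper_def)
  obtain m' where m': "m = Suc m'" using assms(4) gr0_implies_Suc by blast
  \<comment> \<open>The successor accounts for the final edge, down to level
    \<open>j\<close>.\<close>
  have R: "Suc (?R + Y) = (2 * m - 1) * Y + m" by (simp add: m' algebra_simps)
  have inV: "x \<in> V" if "(u, x) \<in> ?A\<^sup>*" for x
    using that u(1) assms(3) by (induction rule: rtrancl_induct) (auto simp: upper_def)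
  have finish: "\<exists>w\<in>near (upper lev j C) ((2 * m - 1) * Y + m) u. lev w = j"
    if w: "w \<in> near ?A (?R + Y) u" "(w, w') \<in> C" "lev w' = j" "j \<le> lev w" for w w'
  proof -
    have "w \<in> near (upper lev j C) (?R + Y) u" using w(1) near_mono[OF AC order_refl, of "?R + Y" u] by auto
    moreover have "(w, w') \<in> upper lev j C" using w by (auto simp: upper_def)
    ultimately have "w' \<in> near (upper lev j C) (Suc (?R + Y)) u" by (rule near_step)
    then show ?thesis using w(3) unfolding R by blast
  qed
  show ?thesis
  proof (cases "\<exists>y. (u, y) \<in> ?A\<^sup>* \<and> y \<notin> near ?A ?R u")
    case True
    then obtain y where y: "(u, y) \<in> ?A\<^sup>*" "y \<notin> near ?A ?R u" by blast
    have "near ?A Y x \<inter> {w \<in> V. lev w = Suc j} \<noteq> {}" if x: "(u, x) \<in> ?A\<^sup>*" for x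
    proof -
      obtain w where w: "w \<in> near ?A Y x" "lev w = Suc j"
        using IH[OF inV[OF x] upper_rtrancl_level[OF x uj]] by blast
      then have "w \<in> V" using inV near_imp_rtrancl x rtrancl_trans by metis
      then show ?thesis using w by blast
    qed
    then have "m \<le> card (near ?A (?R + Y) u \<inter> {w \<in> V. lev w = Suc j})"
      using many_near_or_all_near[OF sym_upper[OF assms(1)] _ _ y] assms(2) by simp
    then obtain w w' where "w \<in> near ?A (?R + Y) u" "lev w = Suc j" "(w, w') \<in> C" "lev w' = j"
      using good[OF u(1)] by blast
    then show ?thesis using finish[of w w'] by simp
  next
    case False
    \<comment> \<open>The level of the root is too small for it to lie in the component, so some
      edge leaves the component on the way there. Levels change by at most one along an edge, hence
      this edge ends exactly on level \<open>j\<close>.\<close>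
    have "(u, r) \<notin> ?A\<^sup>*" using upper_rtrancl_level[of u r lev "Suc j" C] uj root(1) by auto
    with root(2)[OF u(1)] have "\<exists>x y. (x, y) \<in> C \<and> (u, x) \<in> ?A\<^sup>* \<and> (u, y) \<notin> ?A\<^sup>*"
      by (induction rule: rtrancl_induct) blast+
    then obtain x y where xy: "(x, y) \<in> C" "(u, x) \<in> ?A\<^sup>*" "(u, y) \<notin> ?A\<^sup>*" by blast
    have lx: "Suc j \<le> lev x" using upper_rtrancl_level[OF xy(2) uj] .
    have "(x, y) \<notin> ?A" using xy by (meson rtrancl_into_rtrancl)
    then have "lev y < Suc j" using lx xy(1) by (auto simp: upper_def)
    moreover have "lev x \<le> Suc (lev y)" using lev_step xy(1) assms(1) by (meson symD)
    ultimately have ly: "lev y = j" using lx by simp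
    have "x \<in> near ?A ?R u" using False xy(2) by blast
    then have "x \<in> near ?A (?R + Y) u" using near_mono[OF subset_refl, of ?R "?R + Y" ?A u] by auto
    from finish[OF this xy(1) ly] show ?thesis using lx by simp
  qed
qed

section \<open>Iteration over all levels\<close>

fun descent_radius :: "nat \<Rightarrow> nat \<Rightarrow> nat" where
  "descent_radius m 0 = 0"
| "descent_radius m (Suc j) = (2 * m - 1) * descent_radius m j + m"

text \<open>In the form \<open>2 * Y + 1\<close> the recursion becomes multiplicative: each level
  costs at most a factor \<open>2 * m + 1\<close>.\<close>

lemma descent_radius_le: "m > 0 \<Longrightarrow> 2 * descent_radius m j + 1 \<le> (2 * m + 1) ^ j"
proof (induction j)
  case (Suc j)
  let ?Y = "descent_radius m j"
  have "2 * descent_radius m (Suc j) + 1 \<le> (2 * m + 1) * (2 * ?Y + 1)"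
    using Suc.prems by (cases m) (auto simp: algebra_simps)
  also have "\<dots> \<le> (2 * m + 1) * (2 * m + 1) ^ j" using Suc by (intro mult_le_mono) auto
  finally show ?case by simp
qed simp

text \<open>The induction starts at the deepest level \<open>D\<close>, where nothing has to be
  done, and moves towards the root. Level \<open>j\<close> is thus reached within
  \<open>descent_radius m (D - j)\<close>, which explains the index in \<open>good\<close>.\<close>

lemma descend_to_root:
  fixes C :: "('v \<times> 'v) set" and lev :: "'v \<Rightarrow> nat"
  assumes "sym C" "finite V" "C \<subseteq> V \<times> V" "m > 0"
    and lev_step: "\<And>x y. (x, y) \<in> C \<Longrightarrow> lev y \<le> Suc (lev x)"
    and root: "lev r = 0" "\<And>u. u \<in> V \<Longrightarrow> (u, r) \<in> C\<^sup>*"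
    and depth: "\<And>u. u \<in> V \<Longrightarrow> lev u \<le> D"
    and good: "\<And>u j Y. u \<in> V \<Longrightarrow> Y = descent_radius m (D - Suc j) \<Longrightarrow>
        m \<le> card (near (upper lev (Suc j) C) ((m - 1) * (2 * Y + 1) + Y) u \<inter> {w \<in> V. lev w = Suc j}) \<Longrightarrow>
        \<exists>w\<in>near (upper lev (Suc j) C) ((m - 1) * (2 * Y + 1) + Y) u. \<exists>w'.
          lev w = Suc j \<and> (w, w') \<in> C \<and> lev w' = j"
    and u: "u \<in> V"
  shows "\<exists>w\<in>near C (descent_radius m D) u. lev w = 0"
proof -
  have "\<forall>u\<in>V. D - i \<le> lev u \<longrightarrow> (\<exists>w\<in>near (upper lev (D - i) C) (descent_radius m i) u. lev w = D - i)"
    if "i \<le> D" for i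
    using that
  proof (induction i)
    case 0
    have "lev v = D" if "v \<in> V" "D - 0 \<le> lev v" for v using depth[OF that(1)] that(2) by simp
    then show ?case using near_refl by (metis diff_zero)
  next
    case (Suc i)
    define j where "j = D - Suc i"
    have j: "D - i = Suc j" "D - Suc i = j" "i = D - Suc j" using Suc.prems by (auto simp: j_def)
    show ?case
    proof (intro ballI impI)
      fix v assume v: "v \<in> V" "D - Suc i \<le> lev v"
      have IH: "\<exists>w\<in>near (upper lev (Suc j) C) (descent_radius m i) x. lev w = Suc j"
        if "x \<in> V" "Suc j \<le> lev x" for x
        using Suc.IH Suc.prems that unfolding j(1) by auto
      have "\<exists>w\<in>near (upper lev j C) ((2 * m - 1) * descent_radius m i + m) v. lev w = j"
        by (rule descend_one_level[OF assms(1-4) lev_step root IH good])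
           (use v j in auto)
      then show "\<exists>w\<in>near (upper lev (D - Suc i) C) (descent_radius m (Suc i)) v. lev w = D - Suc i"
        unfolding j(2) by simp
    qed
  qed
  from this[of D] obtain w where "w \<in> near (upper lev 0 C) (descent_radius m D) u" "lev w = 0"
    using u by auto
  moreover have "upper lev 0 C \<subseteq> C" by (auto simp: upper_def)
  then have "near (upper lev 0 C) (descent_radius m D) u \<subseteq> near C (descent_radius m D) u"
    by (rule near_mono) simp
  ultimately show ?thesis by auto
qed

subsection \<open>The diameter of the sampled graph\<close>

lemma graph_dist_le_iff: "graph_dist G u v \<le> enat r \<longleftrightarrow> v \<in> near (adj G) r u"
proof
  assume le: "graph_dist G u v \<le> enat r"
  let ?L = "{l. (u, v) \<in> adj G ^^ l}"
  \<comment> \<open>A finite value excludes the empty set of walks, and a nonempty infimum in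
    \<open>enat\<close> is attained.\<close>
  have "?L \<noteq> {}" using le unfolding graph_dist_def Inf_enat_def by (auto split: if_splits)
  then have "graph_dist G u v \<in> enat ` ?L"
    unfolding graph_dist_def Inf_enat_def by (auto intro: LeastI)
  then show "v \<in> near (adj G) r u" using le by (auto simp: near_def)
next
  assume "v \<in> near (adj G) r u"
  then obtain l where "l \<le> r" "(u, v) \<in> adj G ^^ l" by (auto simp: near_def)
  then show "graph_dist G u v \<le> enat r"
    unfolding graph_dist_def by (intro INF_lower2[of l]) auto
qed

lemma graph_diameter_le_iff:
  "graph_diameter G \<le> enat r \<longleftrightarrow> (\<forall>u\<in>verts G. \<forall>v\<in>verts G. v \<in> near (adj G) r u)"
  by (simp add: graph_diameter_def SUP_le_iff graph_dist_le_iff)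

section \<open>Levels and parent edges\<close>

definition level :: "('v, 'e) multigraph \<Rightarrow> 'v \<Rightarrow> 'v \<Rightarrow> nat" where
  "level G r v = (LEAST l. (r, v) \<in> adj G ^^ l)"

text \<open>Without reachability \<open>LEAST\<close> would range over an empty set and its value
  would be unspecified.\<close>

lemma level_relpow: "(r, v) \<in> (adj G)\<^sup>* \<Longrightarrow> (r, v) \<in> adj G ^^ level G r v"
  unfolding level_def by (metis LeastI rtrancl_power)

lemma level_le: "(r, v) \<in> adj G ^^ l \<Longrightarrow> level G r v \<le> l"
  unfolding level_def by (rule Least_le)

lemma level_root: "level G r r = 0"
  using level_le[of r r 0 G] by simp

lemma level_step:
  assumes "(r, x) \<in> (adj G)\<^sup>*" "(x, y) \<in> adj G"
  shows "level G r y \<le> Suc (level G r x)"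
  using level_relpow[OF assms(1)] assms(2) by (intro level_le) auto

lemma level_eq_0: "(r, v) \<in> (adj G)\<^sup>* \<Longrightarrow> level G r v = 0 \<Longrightarrow> v = r"
  using level_relpow[of r v G] by simp

lemma level_parent:
  assumes "(r, v) \<in> (adj G)\<^sup>*" "level G r v = Suc j"
  shows "\<exists>e w. e \<in> edges G \<and> ends G e = {w, v} \<and> level G r w = j"
proof -
  obtain w where w: "(r, w) \<in> adj G ^^ j" "(w, v) \<in> adj G"
    using level_relpow[OF assms(1)] assms(2) by auto
  then have "level G r w \<le> j" "Suc j \<le> Suc (level G r w)"
    using level_le level_step[of r w G v] assms(2) relpow_imp_rtrancl by metis+
  then show ?thesis using w(2) by (auto simp: adj_def)
qed

text \<open>One edge per vertex is fixed in \<open>G\<close> ahead of sampling, although several may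
  qualify. The edges tested in a descent are then a function of the vertices found.\<close>

definition parent_edge :: "('v, 'e) multigraph \<Rightarrow> 'v \<Rightarrow> 'v \<Rightarrow> 'e" where
  "parent_edge G r v =
     (SOME e. e \<in> edges G \<and> (\<exists>w. ends G e = {w, v} \<and> Suc (level G r w) = level G r v))"

lemma parent_edge:
  assumes "(r, v) \<in> (adj G)\<^sup>*" "level G r v = Suc j"
  obtains w where "parent_edge G r v \<in> edges G" "ends G (parent_edge G r v) = {w, v}" "level G r w = j"
proof -
  have "\<exists>e. e \<in> edges G \<and> (\<exists>w. ends G e = {w, v} \<and> Suc (level G r w) = level G r v)"
    using level_parent[OF assms] assms(2) by auto
  from someI_ex[OF this] show ?thesis using that assms(2) unfolding parent_edge_def by auto
qed

text \<open>The endpoint on the higher level identifies the vertex, so vertices with a common parent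
  still have different edges.\<close>

lemma parent_edge_inj_on:
  assumes "\<And>v. v \<in> A \<Longrightarrow> (r, v) \<in> (adj G)\<^sup>* \<and> level G r v = Suc j"
  shows "inj_on (parent_edge G r) A"
proof (rule inj_onI)
  fix v v' assume v: "v \<in> A" "v' \<in> A" "parent_edge G r v = parent_edge G r v'"
  obtain w where "ends G (parent_edge G r v) = {w, v}" "level G r w = j"
    using parent_edge[of r v G j] assms[OF v(1)] by blast
  moreover obtain w' where "ends G (parent_edge G r v') = {w', v'}" "level G r w' = j"
    using parent_edge[of r v' G j] assms[OF v(2)] by blast
  ultimately show "v = v'" using v(3) assms[OF v(1)] assms[OF v(2)]
    by (metis doubleton_eq_iff n_not_Suc_n)
qed

section \<open>The exploration and the edges it leaves unexposed\<close>

definition exposed_parents ::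
    "('v, 'e) multigraph \<Rightarrow> 'v \<Rightarrow> nat \<Rightarrow> nat \<Rightarrow> 'v \<Rightarrow> ('e \<Rightarrow> bool) \<Rightarrow> 'e set" where
  "exposed_parents G r i s u \<omega> = parent_edge G r `
     (near (upper (level G r) i (adj (spanning_subgraph G {e \<in> edges G. \<omega> e}))) s u
        \<inter> {w \<in> verts G. level G r w = i})"

text \<open>Failure of the hypothesis \<open>good\<close> of \<open>descend_to_root\<close>, for a
  single start \<open>u\<close> and a single level \<open>i\<close>.\<close>

definition blocked ::
    "('v, 'e) multigraph \<Rightarrow> 'v \<Rightarrow> nat \<Rightarrow> nat \<Rightarrow> nat \<Rightarrow> 'v \<Rightarrow> ('e \<Rightarrow> bool) set" where
  "blocked G r m i s u = {\<omega>. m \<le> card (exposed_parents G r i s u \<omega>) \<and>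
     (\<forall>e\<in>exposed_parents G r i s u \<omega>. \<not> \<omega> e)}"

text \<open>The exploration reads only edges with both ends on levels from \<open>i\<close> on,
  whereas the parent edge of a vertex on level \<open>i\<close> has an end on the level before.
  Hence deferred decisions apply.\<close>

lemma (in fin_multigraph) prob_blocked_le:
  assumes "graph_connected G" "r \<in> verts G" "i > 0" "0 \<le> p" "p \<le> 1"
  shows "measure_pmf.prob (Pi_pmf (edges G) False (\<lambda>_. bernoulli_pmf p)) (blocked G r m i s u)
         \<le> (1 - p) ^ m"
  unfolding blocked_def
proof (rule prob_exposed_absent_edges_le[where F = "{e \<in> edges G. \<forall>x\<in>ends G e. i \<le> level G r x}"])
  show "exposed_parents G r i s u \<omega> = exposed_parents G r i s u \<omega>'"
    if "\<forall>e\<in>{e \<in> edges G. \<forall>x\<in>ends G e. i \<le> level G r x}. \<omega> e = \<omega>' e" for \<omega> \<omega>'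
  proof -
    have "upper (level G r) i (adj (spanning_subgraph G {e \<in> edges G. \<omega> e}))
        = upper (level G r) i (adj (spanning_subgraph G {e \<in> edges G. \<omega>' e}))"
      using that by (fastforce simp: upper_def adj_def spanning_subgraph_def)
    then show ?thesis by (simp add: exposed_parents_def)
  qed
  show "exposed_parents G r i s u \<omega> \<subseteq> edges G - {e \<in> edges G. \<forall>x\<in>ends G e. i \<le> level G r x}" for \<omega>
  proof
    fix e assume "e \<in> exposed_parents G r i s u \<omega>"
    then obtain w where w: "e = parent_edge G r w" "w \<in> verts G" "level G r w = i"
      by (auto simp: exposed_parents_def)
    obtain j where j: "i = Suc j" using assms(3) gr0_implies_Suc by blast
    have "(r, w) \<in> (adj G)\<^sup>*" using assms(1,2) w(2) by (auto simp: graph_connected_def)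
    then obtain w' where "e \<in> edges G" "ends G e = {w', w}" "level G r w' = j"
      using parent_edge[of r w G j] w(1,3) j by blast
    then show "e \<in> edges G - {e \<in> edges G. \<forall>x\<in>ends G e. i \<le> level G r x}" using j by auto
  qed
qed (use assms finite_edges in auto)

text \<open>Levels are taken in \<open>G\<close>, which contains the sample, so sampled edges change
  them by at most one. Two descents meeting in \<open>r\<close> give the factor 2.\<close>

lemma (in fin_multigraph) diameter_sampled_le:
  assumes conn: "graph_connected G" and r: "r \<in> verts G" and m: "m > 0"
    and depth: "\<And>v. v \<in> verts G \<Longrightarrow> level G r v \<le> D"
    and conn': "graph_connected (spanning_subgraph G {e \<in> edges G. \<omega> e})"
    and unblocked: "\<And>u j Y. u \<in> verts G \<Longrightarrow> Suc j \<in> level G r ` verts G \<Longrightarrow>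
        Y = descent_radius m (D - Suc j) \<Longrightarrow>
        \<omega> \<notin> blocked G r m (Suc j) ((m - 1) * (2 * Y + 1) + Y) u"
  shows "graph_diameter (spanning_subgraph G {e \<in> edges G. \<omega> e}) \<le> enat (2 * descent_radius m D)"
proof -
  let ?H = "spanning_subgraph G {e \<in> edges G. \<omega> e}"
  interpret H: fin_multigraph ?H
    by (rule fin_multigraph_spanning_subgraph[OF fin_multigraph_axioms]) auto
  have vH: "verts ?H = verts G" by (simp add: spanning_subgraph_def)
  have adjH: "adj ?H \<subseteq> adj G" by (auto simp: adj_def spanning_subgraph_def)
  have reach: "(r, v) \<in> (adj G)\<^sup>*" if "v \<in> verts G" for v
    using conn r that by (auto simp: graph_connected_def)
  have to_root: "r \<in> near (adj ?H) (descent_radius m D) u" if u: "u \<in> verts G" for u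
  proof -
    have "\<exists>w\<in>near (adj ?H) (descent_radius m D) u. level G r w = 0"
    proof (rule descend_to_root[where V = "verts G" and r = r])
      show "adj ?H \<subseteq> verts G \<times> verts G" using H.adj_verts vH by auto
      show "level G r y \<le> Suc (level G r x)" if "(x, y) \<in> adj ?H" for x y
        using level_step[of r x G y] reach adjH adj_verts that by blast
      show "(u, r) \<in> (adj ?H)\<^sup>*" if "u \<in> verts G" for u
        using conn' that r by (auto simp: graph_connected_def vH)
      fix u j Y
      let ?N = "near (upper (level G r) (Suc j) (adj ?H)) ((m - 1) * (2 * Y + 1) + Y) u"
      let ?L = "{w \<in> verts G. level G r w = Suc j}"
      assume u: "u \<in> verts G" and Y: "Y = descent_radius m (D - Suc j)" and big: "m \<le> card (?N \<inter> ?L)"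
      have "inj_on (parent_edge G r) (?N \<inter> ?L)"
        by (rule parent_edge_inj_on) (use reach in auto)
      then have c: "m \<le> card (exposed_parents G r (Suc j) ((m - 1) * (2 * Y + 1) + Y) u \<omega>)"
        using big by (simp add: exposed_parents_def card_image)
      \<comment> \<open>Only occupied levels have to be unblocked, which keeps the later union bound
        independent of \<open>D\<close>.\<close>
      have "?N \<inter> ?L \<noteq> {}" using big m by (metis card.empty not_le)
      then have "Suc j \<in> level G r ` verts G" by force
      then obtain e where e: "e \<in> exposed_parents G r (Suc j) ((m - 1) * (2 * Y + 1) + Y) u \<omega>" "\<omega> e"
        using unblocked[OF u _ Y] c by (auto simp: blocked_def)
      then obtain w where w: "w \<in> ?N" "w \<in> ?L" "e = parent_edge G r w"
        by (auto simp: exposed_parents_def)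
      obtain w' where w': "e \<in> edges G" "ends G e = {w', w}" "level G r w' = j"
        using parent_edge[of r w G j] reach w by blast
      have "(w, w') \<in> adj ?H"
        using w' e(2) by (auto simp: adj_def spanning_subgraph_def insert_commute)
      then show "\<exists>w\<in>?N. \<exists>w'. level G r w = Suc j \<and> (w, w') \<in> adj ?H \<and> level G r w' = j"
        using w w' by auto
    qed (use finite_verts depth m u in \<open>auto simp: sym_adj level_root\<close>)
    then obtain w where w: "w \<in> near (adj ?H) (descent_radius m D) u" "level G r w = 0" by blast
    have "(u, w) \<in> (adj G)\<^sup>*" using near_imp_rtrancl[OF w(1)] adjH rtrancl_mono by blast
    then have "(r, w) \<in> (adj G)\<^sup>*" using reach[OF u] by (rule rtrancl_trans[rotated])
    then show ?thesis using level_eq_0 w by metis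
  qed
  have "v \<in> near (adj ?H) (2 * descent_radius m D) u" if "u \<in> verts G" "v \<in> verts G" for u v
    using near_trans[OF to_root[OF that(1)] near_sym[OF sym_adj to_root[OF that(2)]]] by (simp add: mult_2)
  then show ?thesis by (simp add: graph_diameter_le_iff vH)
qed

text \<open>Disconnection has probability at most \<open>1 / n ^ 2\<close>. There are at most
  \<open>n ^ 2\<close> pairs of a start and a level, each blocked with probability at most
  \<open>1 / n ^ 4\<close>. The total \<open>2 / n ^ 2\<close> is at most
  \<open>1 / n\<close>.\<close>

lemma (in fin_multigraph) prob_connected_small_diameter:
  assumes n: "card (verts G) = n" "n \<ge> 2" and k: "real k > 1000 * ln (real n)"
    and p: "707 * ln (real n) / real k \<le> p" "p \<le> 1"
    and kc: "k_edge_connected k G" and diam: "graph_diameter G \<le> enat D"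
  shows "measure_pmf.prob (random_subgraph p G)
           {H. graph_connected H \<and> graph_diameter H \<le> enat (k ^ D)} \<ge> 1 - 1 / n"
proof -
  define L where "L = ln (real n)"
  \<comment> \<open>Large enough for \<open>m * p\<close> to reach \<open>4 * ln n\<close>, small
    enough for \<open>2 * m + 1 \<le> k\<close>.\<close>
  define m where "m = k div 4"
  let ?M = "Pi_pmf (edges G) False (\<lambda>_. bernoulli_pmf p)"
  let ?S = "\<lambda>\<omega>. spanning_subgraph G {e \<in> edges G. \<omega> e}"
  \<comment> \<open>This yields \<open>k > 500\<close> and makes \<open>707 * L\<close> exceed the
    threshold \<open>8 + 4 * L\<close> of \<open>prob_disconnected_le\<close>.\<close>
  have L: "1/2 \<le> L"
  proof -
    have "1 - 1 / (2::real) \<le> ln 2" using ln_le_minus_one[of "1/2::real"] by (simp add: ln_div)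
    also have "ln 2 \<le> L" unfolding L_def using n(2) by simp
    finally show ?thesis by simp
  qed
  have k500: "k > 500" using k L by (simp add: L_def)
  have m0: "m > 0" and mk: "2 * m + 1 \<le> k" using k500 by (auto simp: m_def)
  have p0: "0 \<le> p" using p(1) L k500 by (smt (verit) L_def divide_nonneg_nonneg of_nat_0_le_iff)
  have en: "exp (- (real a * L)) = 1 / real n ^ a" for a
    using n(2) by (simp add: L_def exp_minus exp_of_nat_mult inverse_eq_divide)
  have pm: "(1 - p) ^ m \<le> 1 / real n ^ 4"
  proof -
    have "k \<le> 4 * m + 3" unfolding m_def by simp
    then have "4 * real k \<le> 707 * real m" using k500 by linarith
    then have "4 * L * k \<le> 707 * L * m" using mult_left_mono[of "4 * real k" "707 * real m" L] L by simp
    then have "4 * L \<le> 707 * L / k * m" using k500 by (simp add: field_simps)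
    also have "\<dots> \<le> p * m" using p(1) by (intro mult_right_mono) (auto simp: L_def)
    finally have pL: "4 * L \<le> m * p" by (simp add: mult.commute)
    have "(1 - p) ^ m \<le> exp (- p) ^ m"
      using exp_ge_add_one_self[of "- p"] p(2) by (intro power_mono) auto
    also have "\<dots> = exp (- (m * p))" by (simp add: exp_of_nat_mult[symmetric])
    also have "\<dots> \<le> exp (- (real 4 * L))" using pL by simp
    finally show ?thesis unfolding en .
  qed
  obtain r where r: "r \<in> verts G" using n by fastforce
  have V: "v \<in> near (adj G) D r" if "v \<in> verts G" for v
    using diam r that by (simp add: graph_diameter_le_iff)
  have depth: "level G r v \<le> D" if "v \<in> verts G" for v
    using V[OF that] level_le by (force simp: near_def)
  have "graph_connected (spanning_subgraph G (edges G - {}))"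
    using kc unfolding k_edge_connected_def by (metis card.empty empty_subsetI le0)
  then have conn: "graph_connected G" by (simp add: spanning_subgraph_def)
  define B where "B = (\<lambda>(u, i). let Y = descent_radius m (D - i) in
     blocked G r m i ((m - 1) * (2 * Y + 1) + Y) u)"
  define I where "I = verts G \<times> (level G r ` verts G - {0})"
  let ?C = "{\<omega>. \<not> graph_connected (?S \<omega>)}"
  have finI: "finite I" using finite_verts by (simp add: I_def)
  have cardI: "card I \<le> n ^ 2"
  proof -
    have "card (level G r ` verts G - {0}) \<le> n"
      using card_image_le[OF finite_verts] card_Diff1_le[of _ 0] n(1) le_trans by metis
    then show ?thesis using n(1) by (simp add: I_def card_cartesian_product power2_eq_square)
  qed
  have "- {\<omega>. graph_connected (?S \<omega>) \<and> graph_diameter (?S \<omega>) \<le> enat (k ^ D)} \<subseteq> ?C \<union> \<Union> (B ` I)"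
  proof (rule ccontr)
    assume "\<not> ?thesis"
    then obtain \<omega> where w: "graph_connected (?S \<omega>)" "\<not> graph_diameter (?S \<omega>) \<le> enat (k ^ D)"
      "\<And>u i. (u, i) \<in> I \<Longrightarrow> \<omega> \<notin> B (u, i)" by blast
    have "graph_diameter (?S \<omega>) \<le> enat (2 * descent_radius m D)"
    proof (rule diameter_sampled_le[OF conn r m0 depth w(1)])
      fix u j Y
      assume "u \<in> verts G" "Suc j \<in> level G r ` verts G" "Y = descent_radius m (D - Suc j)"
      then show "\<omega> \<notin> blocked G r m (Suc j) ((m - 1) * (2 * Y + 1) + Y) u"
        using w(3)[of u "Suc j"] by (simp add: I_def B_def Let_def)
    qed
    also have "2 * descent_radius m D \<le> (2 * m + 1) ^ D" using descent_radius_le[OF m0, of D] by simp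
    also have "\<dots> \<le> k ^ D" using mk by (intro power_mono) auto
    finally show False using w(2) by simp
  qed
  then have "measure_pmf.prob ?M (- {\<omega>. graph_connected (?S \<omega>) \<and> graph_diameter (?S \<omega>) \<le> enat (k ^ D)})
     \<le> measure_pmf.prob ?M (?C \<union> \<Union> (B ` I))"
    by (intro measure_pmf.finite_measure_mono) auto
  also have "\<dots> \<le> measure_pmf.prob ?M ?C + measure_pmf.prob ?M (\<Union> (B ` I))"
    by (rule measure_Un_le) auto
  also have "\<dots> \<le> 1 / real n ^ 2 + 1 / real n ^ 2"
  proof (rule add_mono)
    \<comment> \<open>Here \<open>lam\<close> is \<open>707 * L\<close>; half of it is at least
      \<open>6 * L\<close>, which outweighs the factor \<open>n ^ 4\<close>.\<close>
    have "measure_pmf.prob ?M ?C \<le> real (card (verts G) ^ 4) * exp (- ((707 * L) / 2))"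
      using kc k500 r L p n by (intro prob_disconnected_le) (auto simp: L_def)
    also have "\<dots> \<le> real (n ^ 4) * exp (- (real 6 * L))"
      unfolding n(1) using L by (intro mult_left_mono) auto
    also have "\<dots> = 1 / real n ^ 2" unfolding en using n(2) by (simp add: field_simps flip: power_add)
    finally show "measure_pmf.prob ?M ?C \<le> 1 / real n ^ 2" .
    have "measure_pmf.prob ?M (\<Union> (B ` I)) \<le> (\<Sum>x\<in>I. measure_pmf.prob ?M (B x))"
      by (rule measure_pmf.finite_measure_subadditive_finite[OF finI]) auto
    also have "\<dots> \<le> (\<Sum>x\<in>I. 1 / real n ^ 4)"
    proof (rule sum_mono)
      fix x assume "x \<in> I"
      then obtain u i where x: "x = (u, i)" "i > 0" by (auto simp: I_def)
      show "measure_pmf.prob ?M (B x) \<le> 1 / real n ^ 4"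
        using prob_blocked_le[OF conn r x(2) p0 p(2)] pm unfolding x(1) B_def Let_def
        by (auto intro: order_trans)
    qed
    also have "\<dots> = real (card I) * (1 / real n ^ 4)" by simp
    also have "\<dots> \<le> real (n ^ 2) * (1 / real n ^ 4)"
      using cardI by (intro mult_right_mono of_nat_mono) auto
    also have "\<dots> = 1 / real n ^ 2" using n(2) by (simp add: field_simps flip: power_add)
    finally show "measure_pmf.prob ?M (\<Union> (B ` I)) \<le> 1 / real n ^ 2" .
  qed
  also have "\<dots> \<le> 1 / n" using n(2) by (simp add: power2_eq_square field_simps)
  finally have "1 - 1 / n \<le> measure_pmf.prob ?M {\<omega>. graph_connected (?S \<omega>) \<and> graph_diameter (?S \<omega>) \<le> enat (k ^ D)}"
    using measure_pmf.prob_compl[of "{\<omega>. graph_connected (?S \<omega>) \<and> graph_diameter (?S \<omega>) \<le> enat (k ^ D)}" ?M]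
    by (simp add: Compl_eq_Diff_UNIV)
  then show ?thesis by (simp add: random_subgraph_def vimage_def)
qed

theorem theorem4p1:
  "\<exists>c::nat. c \<ge> 1 \<and>
     (\<forall>(k::nat) (D::nat) (n::nat) (p::real) (G::('v, 'e) multigraph).
        k > 0 \<longrightarrow> D > 0 \<longrightarrow> n > 0 \<longrightarrow>
        real k > 1000 * ln (real n) \<longrightarrow>
        707 * ln (real n) / real k \<le> p \<longrightarrow> p \<le> 1 \<longrightarrow>
        fin_multigraph G \<longrightarrow> card (verts G) = n \<longrightarrow>
        k_edge_connected k G \<longrightarrow> graph_diameter G = enat D \<longrightarrow>
        measure_pmf.prob (random_subgraph p G)
          {G'. graph_connected G' \<and> graph_diameter G' \<le> enat (k ^ (D * (D + 1) div 2))}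
        \<ge> 1 - 1 / real n ^ c)"
proof (intro exI[of _ "1::nat"] conjI allI impI)
  fix k D n :: nat and p :: real and G :: "('v, 'e) multigraph"
  assume k0: "k > 0" and D: "D > 0" and n: "n > 0" and k: "real k > 1000 * ln (real n)"
    and p: "707 * ln (real n) / real k \<le> p" "p \<le> 1"
    and fin: "fin_multigraph G" and card: "card (verts G) = n"
    and kc: "k_edge_connected k G" and diam: "graph_diameter G = enat D"
  interpret fin_multigraph G by (rule fin)
  let ?P = "measure_pmf.prob (random_subgraph p G)"
  let ?X = "\<lambda>b. {G'. graph_connected G' \<and> graph_diameter G' \<le> enat b}"
  show "1 - 1 / real n ^ 1 \<le> ?P (?X (k ^ (D * (D + 1) div 2)))"
  \<comment> \<open>With exponent 1 the claimed lower bound is 0 for a single vertex.\<close>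
  proof (cases "n = 1")
    case False
    have "1 - 1 / real n \<le> ?P (?X (k ^ D))"
      by (rule prob_connected_small_diameter) (use False n card k p kc diam in auto)
    also have "\<dots> \<le> ?P (?X (k ^ (D * (D + 1) div 2)))"
    proof (rule measure_pmf.finite_measure_mono)
      \<comment> \<open>As \<open>D\<close> is positive, the exponent \<open>D\<close> already
        obtained is at most the required one.\<close>
      have "D * 2 \<le> D * (D + 1)" using D by (intro mult_le_mono) auto
      then have "D \<le> D * (D + 1) div 2" by linarith
      then have "k ^ D \<le> k ^ (D * (D + 1) div 2)" using k0 by (intro power_increasing) auto
      then show "?X (k ^ D) \<subseteq> ?X (k ^ (D * (D + 1) div 2))"
        by (auto intro: order_trans)
    qed simp
    finally show ?thesis by simp
  qed simp
qed simp

end
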